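(* Let $u_0\in\overline{D(A)}$ and, for each $t\ge0$ and $m\ge1$, set $u_m(t)=\left[T_{t/m}\right]^m u_0$. Then the sequence of functions $(u_m)$ converges pointwise on $[0,\infty)$, and uniformly on $[0,S]$ for each $S>0$, to a function $u:[0,\infty)\to X$, which is globally Lipschitz-continuous with constant $|||(A+B)u_0|||$.
   Context: $X$ is a Banach space whose dual $X^*$ is 2-uniformly convex. Consequently $X$ is reflexive, the duality mapping $j:X\to X^*$, $j(x)=\{x^*\in X^*:\langle x^*,x\rangle=\|x\|^2=\|x^*\|_*^2\}$, is single-valued, and there is a constant $\kappa>0$, fixed from now on, such that $\|u+v\|^2\le\|u\|^2+2\langle j(u),v\rangle+\kappa\|v\|^2$ for all $u,v\in X$. $A:X\to 2^X$ is a set-valued operator with domain $D(A)=\{x\in X: Ax\ne\emptyset\}$. It is m-accretive: accretive means $\|x-y+\lambda(u-v)\|\ge\|x-y\|$ for all $\lambda>0$ whenever $u\in Ax$, $v\in Ay$ (equivalently, $\langle j(x-y),u-v\rangle\ge0$ whenever $u\in Ax$, $v\in Ay$), and m-accretive means that, moreover, $I+\lambda A$ is surjective for all $\lambda>0$. Its resolvent $J_\lambda=(I+\lambda A)^{-1}$ is single-valued and everywhere defined. $B:X\to X$ is cocoercive with parameter $\theta>0$: $\langle j(x-y),Bx-By\rangle\ge\theta\|Bx-By\|^2$ for all $x,y\in X$. For $\lambda>0$, $E_\lambda=I-\lambda B$ and $T_\lambda=J_\lambda\circ E_\lambda:X\to X$ is the forward-backward splitting operator; $T_0$ is understood as the identity,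 so $u_m(0)=u_0$. The power $[T_{t/m}]^m$ denotes $m$-fold composition. Notation: $|||(A+B)x|||=\inf_{v\in Ax}\|v+Bx\|$, with the convention $\inf\emptyset=+\infty$ (so the Lipschitz assertion has content only when $u_0\in D(A)$). *)

theory Defs
  imports "HOL-Analysis.Analysis"
begin

(* The infimum is taken in ereal so that it is +infinity over the empty set
   (zero-dimensional space). *)
definition modulus_of_convexity :: "'b::real_normed_vector itself \<Rightarrow> real \<Rightarrow> ereal" where
  "modulus_of_convexity _ \<epsilon> =
     (INF (x, y) \<in> {(x::'b, y). norm x = 1 \<and> norm y = 1 \<and> norm (x - y) \<ge> \<epsilon>}.
        ereal (1 - norm ((1/2) *\<^sub>R (x + y))))"

definition two_uniformly_convex :: "'b::real_normed_vector itself \<Rightarrow> bool" where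
  "two_uniformly_convex T \<longleftrightarrow>
     (\<exists>c>0. \<forall>\<epsilon>\<in>{0<..2}. modulus_of_convexity T \<epsilon> \<ge> ereal (c * \<epsilon>\<^sup>2))"

definition duality_set :: "'a::real_normed_vector \<Rightarrow> ('a \<Rightarrow>\<^sub>L real) set" where
  "duality_set x = {f. blinfun_apply f x = (norm x)\<^sup>2 \<and> (norm x)\<^sup>2 = (norm f)\<^sup>2}"

(* The description is meaningful because duality_set x is a singleton when the dual is
   2-uniformly convex: nonempty by Hahn-Banach, at most one element by strict convexity. *)
definition duality_map :: "'a::real_normed_vector \<Rightarrow> ('a \<Rightarrow>\<^sub>L real)" where
  "duality_map x = (THE f. f \<in> duality_set x)"

definition op_domain :: "('a \<Rightarrow> 'a set) \<Rightarrow> 'a set" where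
  "op_domain A = {x. A x \<noteq> {}}"

definition accretive :: "('a::real_normed_vector \<Rightarrow> 'a set) \<Rightarrow> bool" where
  "accretive A \<longleftrightarrow>
     (\<forall>x y u v r. u \<in> A x \<longrightarrow> v \<in> A y \<longrightarrow> r > 0 \<longrightarrow>
        norm (x - y + r *\<^sub>R (u - v)) \<ge> norm (x - y))"

definition id_plus_scaled :: "real \<Rightarrow> ('a::real_normed_vector \<Rightarrow> 'a set) \<Rightarrow> 'a \<Rightarrow> 'a set" where
  "id_plus_scaled r A z = {z + r *\<^sub>R v | v. v \<in> A z}"

definition m_accretive :: "('a::real_normed_vector \<Rightarrow> 'a set) \<Rightarrow> bool" where
  "m_accretive A \<longleftrightarrow>
     accretive A \<and> (\<forall>r>0. (\<Union>z. id_plus_scaled r A z) = UNIV)"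

(* For m-accretive A and r > 0 there is exactly one such z. *)
definition resolvent :: "('a::real_normed_vector \<Rightarrow> 'a set) \<Rightarrow> real \<Rightarrow> 'a \<Rightarrow> 'a" where
  "resolvent A r x = (THE z. x \<in> id_plus_scaled r A z)"

definition cocoercive :: "real \<Rightarrow> ('a::real_normed_vector \<Rightarrow> 'a) \<Rightarrow> bool" where
  "cocoercive \<theta> B \<longleftrightarrow>
     (\<forall>x y. blinfun_apply (duality_map (x - y)) (B x - B y) \<ge> \<theta> * (norm (B x - B y))\<^sup>2)"

definition forward_step :: "('a::real_normed_vector \<Rightarrow> 'a) \<Rightarrow> real \<Rightarrow> 'a \<Rightarrow> 'a" where
  "forward_step B r x = x - r *\<^sub>R B x"

(* The value at r = 0 is a convention: (I + 0 A)^{-1} is the identity on the domain of A only. *)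
definition fb_splitting ::
  "('a::real_normed_vector \<Rightarrow> 'a set) \<Rightarrow> ('a \<Rightarrow> 'a) \<Rightarrow> real \<Rightarrow> 'a \<Rightarrow> 'a" where
  "fb_splitting A B r = (if r = 0 then id else resolvent A r \<circ> forward_step B r)"

definition fb_approx ::
  "('a::real_normed_vector \<Rightarrow> 'a set) \<Rightarrow> ('a \<Rightarrow> 'a) \<Rightarrow> 'a \<Rightarrow> nat \<Rightarrow> real \<Rightarrow> 'a" where
  "fb_approx A B u0 m t = (fb_splitting A B (t / real m) ^^ m) u0"

(* In ennreal the infimum over the empty set is \<infinity>. *)
definition min_norm_sum ::
  "('a::real_normed_vector \<Rightarrow> 'a set) \<Rightarrow> ('a \<Rightarrow> 'a) \<Rightarrow> 'a \<Rightarrow> ennreal" where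
  "min_norm_sum A B x = (INF v\<in>A x. ennreal (norm (v + B x)))"

end

theory Submission
  imports Defs "HOL-Real_Asymp.Real_Asymp"
begin

(* Uniform convexity of the dual, in the form
   |(f+g)/2|^2 <= (|f|^2+|g|^2)/2 - c|f-g|^2, makes the duality map single-valued and the
   forward step nonexpansive for step sizes r <= 4 c theta.  (Norming functionals come from a
   minimal sublinear functional: it coincides with its tangents, hence is additive.)  For
   0 <= s <= r in this range the resolvent identity then gives
     |T_r x - T_s y| <= (s/r) |x - y| + (1 - s/r) |T_r x - y|,
   which is the recursion of Crandall and Liggett.  It yields
     |T_r^m x - T_s^n x|^2 <= C^2 ((m r - n s)^2 + n s (r - s))
   with C = |v + B x| for any v in A x.  Taking r = t/m, s = t/n shows that the approximations are
   uniformly Cauchy on bounded intervals, and r = t/m, s = t'/m gives the Lipschitz bound. *)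

section \<open>Norming functionals\<close>

text \<open>Homogeneity is demanded only as an inequality for positive factors, which is easy to
  check for infima; applying it to the inverse factor turns it into an equality.\<close>

definition sublinear :: "('a::real_vector \<Rightarrow> real) \<Rightarrow> bool" where
  "sublinear q \<longleftrightarrow> (\<forall>x y. q (x + y) \<le> q x + q y) \<and> (\<forall>s>0. \<forall>x. q (s *\<^sub>R x) \<le> s * q x)"

lemma sublinearI:
  assumes "\<And>x y. q (x + y) \<le> q x + q y" "\<And>s x. s > 0 \<Longrightarrow> q (s *\<^sub>R x) \<le> s * q x"
  shows "sublinear q"
  using assms by (auto simp: sublinear_def)

lemma sublinear_add: "sublinear q \<Longrightarrow> q (x + y) \<le> q x + q y"
  by (auto simp: sublinear_def)

lemma sublinear_scaleR_le: "sublinear q \<Longrightarrow> s > 0 \<Longrightarrow> q (s *\<^sub>R x) \<le> s * q x"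
  by (auto simp: sublinear_def)

lemma sublinear_zero:
  assumes "sublinear q" shows "q 0 = 0"
  using sublinear_scaleR_le[OF assms, of 2 0] sublinear_scaleR_le[OF assms, of "1/2" 0] by simp

lemma sublinear_scaleR:
  assumes "sublinear q" "s \<ge> 0" shows "q (s *\<^sub>R x) = s * q x"
proof (cases "s = 0")
  case False
  then have s: "s > 0" using assms(2) by simp
  have "q x \<le> (1 / s) * q (s *\<^sub>R x)"
    using sublinear_scaleR_le[OF assms(1), of "1 / s" "s *\<^sub>R x"] s by simp
  then have "s * q x \<le> q (s *\<^sub>R x)" using s by (simp add: field_simps)
  then show ?thesis using sublinear_scaleR_le[OF assms(1) s, of x] by simp
qed (simp add: sublinear_zero[OF assms(1)])

lemma sublinear_minus: "sublinear q \<Longrightarrow> - q (- x) \<le> q x"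
  using sublinear_add[of q x "- x"] sublinear_zero[of q] by simp

lemma sublinear_norm: "sublinear (norm :: 'a::real_normed_vector \<Rightarrow> real)"
  by (rule sublinearI) (auto intro: norm_triangle_ineq)

text \<open>The largest sublinear functional below \<open>q\<close> that takes the value \<open>- q y\<close> at \<open>- y\<close>.\<close>

definition sublinear_tangent :: "('a::real_vector \<Rightarrow> real) \<Rightarrow> 'a \<Rightarrow> 'a \<Rightarrow> real" where
  "sublinear_tangent q y x = (INF t\<in>{0..}. q (x + t *\<^sub>R y) - t * q y)"

lemma sublinear_tangent_le:
  assumes "sublinear q" "t \<ge> 0"
  shows "sublinear_tangent q y x \<le> q (x + t *\<^sub>R y) - t * q y"
  unfolding sublinear_tangent_def
proof (rule cINF_lower)
  \<comment> \<open>The bound does not depend on t: \<open>t * q y = q (t *\<^sub>R y) \<le> q (x +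
    t *\<^sub>R y) + q (- x)\<close>.\<close>
  show "bdd_below ((\<lambda>t. q (x + t *\<^sub>R y) - t * q y) ` {0..})"
  proof (rule bdd_belowI2[where m = "- q (- x)"])
    fix t :: real assume "t \<in> {0..}"
    then have "q (t *\<^sub>R y) = t * q y" using sublinear_scaleR[OF assms(1)] by simp
    then show "- q (- x) \<le> q (x + t *\<^sub>R y) - t * q y"
      using sublinear_add[OF assms(1), of "x + t *\<^sub>R y" "- x"] by simp
  qed
qed (use assms(2) in auto)

lemma sublinear_tangent_greatest:
  assumes "\<And>t. t \<ge> 0 \<Longrightarrow> c \<le> q (x + t *\<^sub>R y) - t * q y"
  shows "c \<le> sublinear_tangent q y x"
  unfolding sublinear_tangent_def by (rule cINF_greatest) (use assms in auto)

lemma sublinear_sublinear_tangent: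
  assumes q: "sublinear q"
  shows "sublinear (sublinear_tangent q y)"
proof (rule sublinearI)
  fix x1 x2
  let ?h = "sublinear_tangent q y"
  have *: "?h (x1 + x2) \<le> (q (x1 + t1 *\<^sub>R y) - t1 * q y) + (q (x2 + t2 *\<^sub>R y) - t2 * q y)"
    if "t1 \<ge> 0" "t2 \<ge> 0" for t1 t2
    using sublinear_tangent_le[OF q, of "t1 + t2" y "x1 + x2"] that
      sublinear_add[OF q, of "x1 + t1 *\<^sub>R y" "x2 + t2 *\<^sub>R y"]
    by (simp add: algebra_simps)
  \<comment> \<open>The infimum is taken over the second parameter with \<open>t1\<close> fixed, and
    then over \<open>t1\<close>.\<close>
  have "?h (x1 + x2) - (q (x1 + t1 *\<^sub>R y) - t1 * q y) \<le> ?h x2" if "t1 \<ge> 0" for t1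
    by (rule sublinear_tangent_greatest) (use *[OF that] in \<open>simp add: algebra_simps\<close>)
  then have "?h (x1 + x2) - ?h x2 \<le> ?h x1"
    by (intro sublinear_tangent_greatest) (simp add: algebra_simps)
  then show "?h (x1 + x2) \<le> ?h x1 + ?h x2" by simp
next
  fix s :: real and x assume s: "s > 0"
  let ?h = "sublinear_tangent q y"
  have "?h (s *\<^sub>R x) / s \<le> ?h x"
  proof (rule sublinear_tangent_greatest)
    fix t :: real assume "t \<ge> 0"
    then have "?h (s *\<^sub>R x) \<le> q (s *\<^sub>R (x + t *\<^sub>R y)) - (s * t) * q y"
      using sublinear_tangent_le[OF q, of "s * t" y "s *\<^sub>R x"] s by (simp add: algebra_simps)
    also have "q (s *\<^sub>R (x + t *\<^sub>R y)) = s * q (x + t *\<^sub>R y)"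
      using sublinear_scaleR[OF q] s by simp
    finally show "?h (s *\<^sub>R x) / s \<le> q (x + t *\<^sub>R y) - t * q y"
      using s by (simp add: field_simps)
  qed
  then show "?h (s *\<^sub>R x) \<le> s * ?h x" using s by (simp add: field_simps)
qed

text \<open>Supplies the bounds of chains for Zorn's lemma. Two members of a chain have a common
  smaller one, so subadditivity of a single functional suffices; the dominating \<open>p\<close>
  keeps the infima above \<open>- p (- x)\<close>.\<close>

lemma sublinear_INF_chain:
  assumes C: "C \<noteq> {}" "\<And>q. q \<in> C \<Longrightarrow> sublinear q \<and> q \<le> p"
    and chain: "\<And>q q'. q \<in> C \<Longrightarrow> q' \<in> C \<Longrightarrow> q \<le> q' \<or> q' \<le> q"
  shows "sublinear (\<lambda>x. INF q\<in>C. q x)" "\<And>q. q \<in> C \<Longrightarrow> (\<lambda>x. INF q\<in>C. q x) \<le> q"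
proof -
  let ?i = "\<lambda>x. INF q\<in>C. q x"
  have lower: "?i x \<le> q x" if "q \<in> C" for q x
  proof (rule cINF_lower[OF _ that])
    show "bdd_below ((\<lambda>q. q x) ` C)"
    proof (rule bdd_belowI2[where m = "- p (- x)"])
      fix q assume "q \<in> C"
      then show "- p (- x) \<le> q x"
        using C(2)[of q] sublinear_minus[of q x] le_funD[of q p "- x"] by auto
    qed
  qed
  show "\<And>q. q \<in> C \<Longrightarrow> ?i \<le> q" using lower by (simp add: le_fun_def)
  show "sublinear ?i"
  proof (rule sublinearI)
    fix x y
    have *: "?i (x + y) \<le> q x + q' y" if "q \<in> C" "q' \<in> C" for q q'
    proof -
      obtain r where "r \<in> C" "r \<le> q" "r \<le> q'"
        using chain[OF \<open>q \<in> C\<close> \<open>q' \<in> C\<close>] \<open>q \<in> C\<close> \<open>q' \<in> C\<close> by blast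
      then have "r (x + y) \<le> r x + r y" "r x \<le> q x" "r y \<le> q' y"
        using C(2)[of r] sublinear_add[of r x y] by (auto simp: le_fun_def)
      then show ?thesis using lower[OF \<open>r \<in> C\<close>, of "x + y"] by linarith
    qed
    have "?i (x + y) - q x \<le> ?i y" if "q \<in> C" for q
      by (rule cINF_greatest[OF C(1)]) (use *[OF that] in \<open>simp add: algebra_simps\<close>)
    then have "?i (x + y) - ?i y \<le> ?i x"
      by (intro cINF_greatest[OF C(1)]) (simp add: algebra_simps)
    then show "?i (x + y) \<le> ?i x + ?i y" by simp
  next
    fix s :: real and x assume s: "s > 0"
    have "?i (s *\<^sub>R x) / s \<le> ?i x"
    proof (rule cINF_greatest[OF C(1)])
      fix q assume q: "q \<in> C"
      have "?i (s *\<^sub>R x) \<le> s * q x"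
        using lower[OF q, of "s *\<^sub>R x"] sublinear_scaleR_le[of q s x] C(2)[OF q] s by simp
      then show "?i (s *\<^sub>R x) / s \<le> q x" using s by (simp add: field_simps)
    qed
    then show "?i (s *\<^sub>R x) \<le> s * ?i x" using s by (simp add: field_simps)
  qed
qed

text \<open>The Hahn-Banach theorem in dominated form, reached without extending functionals from
  subspaces.\<close>

lemma linear_below_sublinear:
  assumes p: "sublinear p"
  obtains f where "linear f" "f \<le> p"
proof -
  let ?S = "{q. sublinear q \<and> q \<le> p}"
  \<comment> \<open>The order is reversed, so that a maximal element in Zorn's lemma is a minimal
    sublinear functional.\<close>
  let ?P = "\<lambda>q q' :: 'a \<Rightarrow> real. q' \<le> q"
  have "\<exists>m\<in>?S. \<forall>a\<in>?S. ?P m a \<longrightarrow> a = m"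
  proof (rule predicate_Zorn)
    show "partial_order_on ?S (relation_of ?P ?S)"
      by (auto simp: partial_order_on_def preorder_on_def refl_on_def trans_on_def antisym_on_def
          relation_of_def)
  next
    fix C assume "C \<in> Chains (relation_of ?P ?S)"
    then have chain: "\<And>q q'. q \<in> C \<Longrightarrow> q' \<in> C \<Longrightarrow> q \<le> q' \<or> q' \<le> q"
      and sub: "\<And>q. q \<in> C \<Longrightarrow> sublinear q \<and> q \<le> p"
      by (auto simp: Chains_def relation_of_def)
    show "\<exists>u\<in>?S. \<forall>a\<in>C. ?P a u"
    proof (cases "C = {}")
      case True
      then show ?thesis using p by auto
    next
      case False
      then obtain q where "q \<in> C" by auto
      then have "(\<lambda>x. INF q\<in>C. q x) \<le> p"
        using sublinear_INF_chain(2)[OF False sub chain, of q] sub[of q] by auto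
      then show ?thesis
        using sublinear_INF_chain[OF False sub chain] by blast
    qed
  qed
  then obtain q where q: "sublinear q" "q \<le> p"
    and min: "\<And>q'. sublinear q' \<Longrightarrow> q' \<le> q \<Longrightarrow> q' = q"
    by (auto intro: order_trans)
  have "sublinear_tangent q y = q" for y
  proof (rule min[OF sublinear_sublinear_tangent[OF q(1)]])
    show "sublinear_tangent q y \<le> q"
      using sublinear_tangent_le[OF q(1), of 0 y] by (simp add: le_fun_def)
  qed
  \<comment> \<open>The tangent inequality at parameter 1 now reads
    \<open>q x \<le> q (x + y) - q y\<close>, the converse of subadditivity.\<close>
  then have add: "q (x + y) = q x + q y" for x y
    using sublinear_tangent_le[OF q(1), of 1 y x] sublinear_add[OF q(1), of x y] by simp
  have minus: "q (- x) = - q x" for x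
    using add[of x "- x"] sublinear_zero[OF q(1)] by simp
  have "q (s *\<^sub>R x) = s * q x" for s x
    using sublinear_scaleR[OF q(1), of s x] sublinear_scaleR[OF q(1), of "- s" x]
      minus[of "s *\<^sub>R x"] by (cases "s \<ge> 0") auto
  then have "linear q" using add by (intro linearI) auto
  then show thesis using that q(2) by blast
qed

text \<open>Domination by the tangent of the norm at \<open>x\<close>, rather than by the norm,
  fixes the value at \<open>x\<close>: parameter 1 at \<open>- x\<close> gives
  \<open>f (- x) \<le> - norm x\<close>, and parameter 0 gives the norm bound.\<close>

lemma norming_functional_exists:
  fixes x :: "'a::real_normed_vector"
  obtains f :: "'a \<Rightarrow>\<^sub>L real" where "norm f \<le> 1" "blinfun_apply f x = norm x"
proof -
  obtain f where lin: "linear f" and le: "f \<le> sublinear_tangent norm x"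
    using linear_below_sublinear[OF sublinear_sublinear_tangent[OF sublinear_norm]] .
  interpret linear f by (rule lin)
  have f_le: "f y \<le> norm (y + t *\<^sub>R x) - t * norm x" if "t \<ge> 0" for t y
    using le_funD[OF le, of y] sublinear_tangent_le[OF sublinear_norm that, of x y] by linarith
  have f_norm: "\<bar>f y\<bar> \<le> norm y" for y
    using f_le[of 0 y] f_le[of 0 "- y"] by (simp add: neg)
  have bl: "bounded_linear f"
    by unfold_locales (use f_norm in \<open>auto intro!: exI[of _ 1]\<close>)
  have "norm (Blinfun f) \<le> 1"
    by (rule norm_blinfun_bound) (simp_all add: bounded_linear_Blinfun_apply[OF bl] f_norm)
  moreover have "f x = norm x"
    using f_le[of 1 "- x"] f_le[of 0 x] by (simp add: neg)
  ultimately show thesis using that[of "Blinfun f"] by (simp add: bounded_linear_Blinfun_apply[OF bl])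
qed

lemma duality_set_nonempty: "duality_set (x :: 'a::real_normed_vector) \<noteq> {}"
proof -
  obtain f :: "'a \<Rightarrow>\<^sub>L real" where f: "norm f \<le> 1" "blinfun_apply f x = norm x"
    by (rule norming_functional_exists)
  \<comment> \<open>At a nonzero vector a norming functional has norm exactly 1, so its multiple by
    \<open>norm x\<close> has the norm that \<open>duality_set\<close> asks for.\<close>
  have "norm x \<le> norm f * norm x" using norm_blinfun[of f x] f(2) by simp
  then have "norm x = 0 \<or> norm f = 1" using f(1) by (cases "norm x = 0") auto
  then have "norm x *\<^sub>R f \<in> duality_set x"
    using f(2) by (auto simp: duality_set_def blinfun.scaleR_left power2_eq_square)
  then show ?thesis by auto
qed

section \<open>Uniform convexity of the dual\<close>

text \<open>The modulus is taken at \<open>norm (f - g)\<close>, where the pair itself competes in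
  the infimum. Equal vectors are treated apart, since the modulus is controlled at positive
  arguments only.\<close>

lemma two_uniformly_convex_midpoint_unit:
  assumes "two_uniformly_convex TYPE('b::real_normed_vector)"
  obtains c where "c > 0"
    "\<And>f g :: 'b. norm f = 1 \<Longrightarrow> norm g = 1 \<Longrightarrow> norm (f + g) \<le> 2 - 2 * c * (norm (f - g))\<^sup>2"
proof -
  obtain c where c: "c > 0"
    and mod: "\<And>e. e \<in> {0<..2} \<Longrightarrow> modulus_of_convexity TYPE('b) e \<ge> ereal (c * e\<^sup>2)"
    using assms by (auto simp: two_uniformly_convex_def)
  have "norm (f + g) \<le> 2 - 2 * c * (norm (f - g))\<^sup>2" if fg: "norm f = 1" "norm g = 1" for f g :: 'b
  proof (cases "f = g")
    case True
    then show ?thesis using norm_triangle_ineq[of f g] fg by simp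
  next
    case False
    then have "norm (f - g) \<in> {0<..2}"
      using norm_triangle_ineq4[of f g] fg by simp
    then have "ereal (c * (norm (f - g))\<^sup>2) \<le> modulus_of_convexity TYPE('b) (norm (f - g))"
      by (rule mod)
    also have "\<dots> \<le> ereal (1 - norm ((1/2) *\<^sub>R (f + g)))"
      unfolding modulus_of_convexity_def by (rule INF_lower2[of "(f, g)"]) (use fg in auto)
    finally show ?thesis by simp
  qed
  then show thesis using that c by blast
qed

text \<open>Splitting \<open>f + g\<close> into \<open>b *\<^sub>R (f' + g')\<close> and
  \<open>(a - b) *\<^sub>R f'\<close> reduces to the unit sphere. Squaring gains (a - b)^2 / 4 from
  the lengths and c (b e)^2 from the directions; both constants are halved because |f - g|^2 is at
  most 2 (a - b)^2 + 2 (b e)^2.\<close>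

lemma norm_midpoint_le:
  fixes f g :: "'b::real_normed_vector"
  assumes c: "c > 0"
    and unit: "\<And>f g :: 'b. norm f = 1 \<Longrightarrow> norm g = 1 \<Longrightarrow>
      norm (f + g) \<le> 2 - 2 * c * (norm (f - g))\<^sup>2"
    and le: "norm g \<le> norm f"
  shows "(norm ((1/2) *\<^sub>R (f + g)))\<^sup>2
    \<le> ((norm f)\<^sup>2 + (norm g)\<^sup>2) / 2 - min (1/8) (c/2) * (norm (f - g))\<^sup>2"
proof -
  define a b f' g' where "a = norm f" and "b = norm g" and "f' = f /\<^sub>R a" and "g' = g /\<^sub>R b"
  define e where "e = norm (f' - g')"
  define h where "h = b * c * e\<^sup>2"
  have ab: "0 \<le> b" "b \<le> a" using le by (auto simp: a_def b_def)
  \<comment> \<open>This includes zero vectors, whose normalization is 0.\<close>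
  have f: "f = a *\<^sub>R f'" and g: "g = b *\<^sub>R g'"
    by (cases "f = 0"; cases "g = 0"; simp add: a_def b_def f'_def g'_def)+
  have f'_le: "norm f' \<le> 1" by (cases "f = 0") (simp_all add: f'_def a_def)
  have "norm (f + g) = norm (b *\<^sub>R (f' + g') + (a - b) *\<^sub>R f')"
    by (subst f, subst g) (simp add: algebra_simps)
  also have "\<dots> \<le> b * norm (f' + g') + (a - b) * norm f'"
    using norm_triangle_ineq[of "b *\<^sub>R (f' + g')" "(a - b) *\<^sub>R f'"] ab by simp
  also have "\<dots> \<le> b * (2 - 2 * c * e\<^sup>2) + (a - b) * 1"
  proof (rule add_mono)
    show "b * norm (f' + g') \<le> b * (2 - 2 * c * e\<^sup>2)"
    proof (cases "b = 0")
      case False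
      then have "f \<noteq> 0" "g \<noteq> 0" using ab by (auto simp: a_def b_def)
      then have "norm f' = 1" "norm g' = 1" by (simp_all add: f'_def g'_def a_def b_def)
      then show ?thesis using unit[of f' g'] ab by (auto simp: e_def intro: mult_left_mono)
    qed simp
    show "(a - b) * norm f' \<le> (a - b) * 1" using f'_le ab by (intro mult_left_mono) auto
  qed
  finally have "norm (f + g) / 2 \<le> (a + b) / 2 - h"
    by (simp add: h_def field_simps)
  moreover have "norm ((1/2) *\<^sub>R (f + g)) = norm (f + g) / 2"
    unfolding norm_scaleR by simp
  ultimately have mid: "norm ((1/2) *\<^sub>R (f + g)) \<le> (a + b) / 2 - h" by simp
  then have h: "0 \<le> h" "h \<le> (a + b) / 2"
    using ab c norm_ge_zero[of "(1/2) *\<^sub>R (f + g)"] unfolding h_def by (simp, linarith)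
  have "(norm ((1/2) *\<^sub>R (f + g)))\<^sup>2 \<le> ((a + b) / 2 - h)\<^sup>2"
    using mid by (intro power_mono) auto
  also have "\<dots> \<le> ((a + b) / 2)\<^sup>2 - b * h"
  proof -
    have "((a + b) / 2 - h)\<^sup>2 = ((a + b) / 2)\<^sup>2 - h * (a + b - h)"
      by (simp add: power2_eq_square algebra_simps)
    \<comment> \<open>Here h \<le> (a + b) / 2 \<le> a, so the second factor is at least b.\<close>
    moreover have "h * b \<le> h * (a + b - h)" using h ab by (intro mult_left_mono) auto
    ultimately show ?thesis by (simp add: mult.commute)
  qed
  also have "\<dots> = (a\<^sup>2 + b\<^sup>2) / 2 - ((1/8) * (2 * (a - b)\<^sup>2) + (c/2) * (2 * (b * e)\<^sup>2))"
    by (simp add: h_def power2_eq_square field_simps)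
  also have "\<dots> \<le> (a\<^sup>2 + b\<^sup>2) / 2 - min (1/8) (c/2) * (2 * (a - b)\<^sup>2 + 2 * (b * e)\<^sup>2)"
    unfolding distrib_left by (intro diff_left_mono add_mono mult_right_mono) auto
  also have "\<dots> \<le> (a\<^sup>2 + b\<^sup>2) / 2 - min (1/8) (c/2) * (norm (f - g))\<^sup>2"
  proof (intro diff_left_mono mult_left_mono)
    have "f - g = (a - b) *\<^sub>R f' + b *\<^sub>R (f' - g')"
      by (subst f, subst g) (simp add: algebra_simps)
    then have "norm (f - g) \<le> (a - b) * norm f' + b * e"
      using norm_triangle_ineq[of "(a - b) *\<^sub>R f'" "b *\<^sub>R (f' - g')"] ab by (simp add: e_def)
    also have "\<dots> \<le> (a - b) + b * e"
      using mult_left_mono[OF f'_le, of "a - b"] ab by simp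
    finally have "(norm (f - g))\<^sup>2 \<le> ((a - b) + b * e)\<^sup>2" by (intro power_mono) auto
    also have "\<dots> \<le> 2 * (a - b)\<^sup>2 + 2 * (b * e)\<^sup>2"
      using zero_le_power2[of "(a - b) - b * e"] by (simp add: power2_eq_square algebra_simps)
    finally show "(norm (f - g))\<^sup>2 \<le> 2 * (a - b)\<^sup>2 + 2 * (b * e)\<^sup>2" .
  qed (use c in auto)
  finally show ?thesis by (simp add: a_def b_def)
qed

text \<open>In a Hilbert space this is the parallelogram law with c = 1/4. The constant is kept
  explicit because it determines the admissible step sizes.\<close>

definition midpoint_convex_with :: "real \<Rightarrow> 'b::real_normed_vector itself \<Rightarrow> bool" where
  "midpoint_convex_with c _ \<longleftrightarrow> c > 0 \<and> (\<forall>f g :: 'b. (norm ((1/2) *\<^sub>R (f + g)))\<^sup>2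
    \<le> ((norm f)\<^sup>2 + (norm g)\<^sup>2) / 2 - c * (norm (f - g))\<^sup>2)"

lemma two_uniformly_convex_midpoint:
  assumes "two_uniformly_convex TYPE('b::real_normed_vector)"
  obtains c where "midpoint_convex_with c TYPE('b)"
proof (rule two_uniformly_convex_midpoint_unit[OF assms])
  fix c :: real
  assume c: "c > 0" and unit: "\<And>f g :: 'b. norm f = 1 \<Longrightarrow> norm g = 1 \<Longrightarrow>
      norm (f + g) \<le> 2 - 2 * c * (norm (f - g))\<^sup>2"
  have "(norm ((1/2) *\<^sub>R (f + g)))\<^sup>2
    \<le> ((norm f)\<^sup>2 + (norm g)\<^sup>2) / 2 - min (1/8) (c/2) * (norm (f - g))\<^sup>2" for f g :: 'b
  proof (cases "norm g \<le> norm f")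
    case True
    with c unit show ?thesis by (rule norm_midpoint_le)
  next
    case False
    then have "norm f \<le> norm g" by simp
    with c unit have "(norm ((1/2) *\<^sub>R (g + f)))\<^sup>2
      \<le> ((norm g)\<^sup>2 + (norm f)\<^sup>2) / 2 - min (1/8) (c/2) * (norm (g - f))\<^sup>2"
      by (rule norm_midpoint_le)
    then show ?thesis
      by (simp only: add.commute[of g f] norm_minus_commute[of g f] add.commute[of "(norm g)\<^sup>2"])
  qed
  then have "midpoint_convex_with (min (1/8) (c/2)) TYPE('b)"
    using c by (auto simp: midpoint_convex_with_def)
  then show thesis by (rule that)
qed

section \<open>Single-valued duality map and nonexpansive forward step\<close>

context
  fixes c :: real
  assumes mid: "midpoint_convex_with c TYPE('a::real_normed_vector \<Rightarrow>\<^sub>L real)"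
begin

text \<open>The subgradient inequality of half the squared norm, improved by a quadratic term:
  evaluate the midpoint of f and g at p, apply Young's inequality, and then midpoint
  convexity.\<close>

lemma duality_set_strongly_monotone:
  fixes p q :: 'a
  assumes f: "f \<in> duality_set p" and g: "g \<in> duality_set q"
  shows "blinfun_apply g (p - q) \<le> ((norm p)\<^sup>2 - (norm q)\<^sup>2) / 2 - c * (norm (f - g))\<^sup>2"
proof -
  let ?h = "(1/2) *\<^sub>R (f + g)"
  have "blinfun_apply f p + blinfun_apply g p = 2 * blinfun_apply ?h p"
    by (simp add: blinfun.scaleR_left blinfun.add_left)
  also have "\<dots> \<le> 2 * (norm ?h * norm p)"
    using norm_blinfun[of ?h p] by (simp add: abs_le_iff)
  also have "\<dots> \<le> (norm ?h)\<^sup>2 + (norm p)\<^sup>2"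
    using zero_le_power2[of "norm ?h - norm p"] by (simp add: power2_eq_square algebra_simps)
  also have "(norm ?h)\<^sup>2 \<le> ((norm f)\<^sup>2 + (norm g)\<^sup>2) / 2 - c * (norm (f - g))\<^sup>2"
    using mid by (simp add: midpoint_convex_with_def)
  finally show ?thesis
    using f g by (simp add: duality_set_def blinfun.diff_right field_simps)
qed

lemma duality_map_mem: "duality_map (x :: 'a) \<in> duality_set x"
proof -
  have "f = g" if "f \<in> duality_set x" "g \<in> duality_set x" for f g
  proof -
    \<comment> \<open>With p = q everything but the quadratic term cancels.\<close>
    have "c * (norm (f - g))\<^sup>2 \<le> 0" using duality_set_strongly_monotone[OF that] by simp
    then show ?thesis using mid by (simp add: midpoint_convex_with_def mult_le_0_iff)
  qed
  then have "\<exists>!f. f \<in> duality_set x" using duality_set_nonempty[of x] by blast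
  then show ?thesis unfolding duality_map_def by (rule theI')
qed

text \<open>Cocoercivity speaks of the functional at u, the subgradient inequality of the one at
  \<open>u - r *\<^sub>R w\<close>. Exchanging them costs at most \<open>d * norm w\<close>, which
  the quadratic term absorbs for small r.\<close>

lemma forward_step_nonexpansive:
  fixes B :: "'a \<Rightarrow> 'a"
  assumes B: "cocoercive \<theta> B" and r: "0 \<le> r" "r \<le> 4 * c * \<theta>"
  shows "norm (forward_step B r x - forward_step B r y) \<le> norm (x - y)"
proof -
  have c: "c > 0" using mid by (simp add: midpoint_convex_with_def)
  define u w where "u = x - y" and "w = B x - B y"
  define f g where "f = duality_map u" and "g = duality_map (u - r *\<^sub>R w)"
  define d where "d = norm (f - g)"
  define k where "k = r * (\<theta> * (norm w)\<^sup>2 - d * norm w)"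
  have "\<theta> * (norm w)\<^sup>2 \<le> blinfun_apply f w"
    using B by (simp add: cocoercive_def f_def u_def w_def)
  also have "\<dots> = blinfun_apply g w + blinfun_apply (f - g) w"
    by (simp add: blinfun.diff_left)
  also have "\<dots> \<le> blinfun_apply g w + d * norm w"
    using norm_blinfun[of "f - g" w] by (simp add: d_def abs_le_iff)
  finally have "k \<le> r * blinfun_apply g w"
    using r unfolding k_def by (intro mult_left_mono) auto
  moreover have "r * blinfun_apply g w
      \<le> ((norm u)\<^sup>2 - (norm (u - r *\<^sub>R w))\<^sup>2) / 2 - c * d\<^sup>2"
    using duality_set_strongly_monotone[OF duality_map_mem duality_map_mem, of "u - r *\<^sub>R w" u]
    by (simp add: f_def g_def d_def blinfun.scaleR_right)
  \<comment> \<open>As a quadratic in d this has a nonpositive discriminant exactly because r \<le>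
    4 c \<theta>; multiplying by 4 c completes the square.\<close>
  moreover have "0 \<le> k + c * d\<^sup>2"
  proof -
    have "r * r * (norm w)\<^sup>2 \<le> r * (4 * c * \<theta>) * (norm w)\<^sup>2"
      using r by (intro mult_right_mono mult_left_mono) auto
    then have "0 \<le> (2 * c * d - r * norm w)\<^sup>2 + r * (4 * c * \<theta>) * (norm w)\<^sup>2 - r * r * (norm w)\<^sup>2"
      using zero_le_power2[of "2 * c * d - r * norm w"] by linarith
    also have "\<dots> = 4 * c * (k + c * d\<^sup>2)"
      by (simp add: k_def power2_eq_square algebra_simps)
    finally show ?thesis using c by (simp add: zero_le_mult_iff)
  qed
  ultimately have "0 \<le> ((norm u)\<^sup>2 - (norm (u - r *\<^sub>R w))\<^sup>2) / 2" by linarith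
  then have "(norm (u - r *\<^sub>R w))\<^sup>2 \<le> (norm u)\<^sup>2" by simp
  moreover have "forward_step B r x - forward_step B r y = u - r *\<^sub>R w"
    by (simp add: forward_step_def u_def w_def algebra_simps)
  ultimately show ?thesis by (simp add: u_def power2_le_iff_abs_le)
qed

end

section \<open>Resolvents and the splitting operator\<close>

lemma accretive_nonexpansive:
  assumes A: "accretive A" and r: "r > 0"
    and x: "x \<in> id_plus_scaled r A z" and y: "y \<in> id_plus_scaled r A z'"
  shows "norm (z - z') \<le> norm (x - y)"
proof -
  obtain u v where "x = z + r *\<^sub>R u" "u \<in> A z" "y = z' + r *\<^sub>R v" "v \<in> A z'"
    using x y by (auto simp: id_plus_scaled_def)
  moreover from this have "norm (z - z') \<le> norm (z - z' + r *\<^sub>R (u - v))"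
    using A r by (auto simp: accretive_def)
  ultimately show ?thesis by (simp add: algebra_simps)
qed

lemma resolvent_mem:
  assumes A: "m_accretive A" and r: "r > 0"
  shows "x \<in> id_plus_scaled r A (resolvent A r x)"
proof -
  have acc: "accretive A" using A by (simp add: m_accretive_def)
  have "x \<in> (\<Union>z. id_plus_scaled r A z)" using A r by (simp add: m_accretive_def)
  moreover have "z = z'" if "x \<in> id_plus_scaled r A z" "x \<in> id_plus_scaled r A z'" for z z'
    using accretive_nonexpansive[OF acc r that] by simp
  ultimately have "\<exists>!z. x \<in> id_plus_scaled r A z" by blast
  then show ?thesis unfolding resolvent_def by (rule theI')
qed

lemma fb_splitting_mem:
  assumes "m_accretive A" "r > 0"
  shows "forward_step B r x \<in> id_plus_scaled r A (fb_splitting A B r x)"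
  using resolvent_mem[OF assms, of "forward_step B r x"] assms(2) by (simp add: fb_splitting_def)

text \<open>For v in A x, the point x is itself the resolvent value at
  \<open>x + r *\<^sub>R v\<close>, so nonexpansiveness of the resolvent compares the two
  arguments.\<close>

lemma fb_splitting_displacement:
  assumes A: "m_accretive A" and r: "r \<ge> 0" and v: "v \<in> A x"
  shows "norm (fb_splitting A B r x - x) \<le> r * norm (v + B x)"
proof (cases "r = 0")
  case False
  then have r: "r > 0" using r by simp
  have "x + r *\<^sub>R v \<in> id_plus_scaled r A x" using v by (auto simp: id_plus_scaled_def)
  then have "norm (fb_splitting A B r x - x) \<le> norm (forward_step B r x - (x + r *\<^sub>R v))"
    using accretive_nonexpansive[OF _ r fb_splitting_mem[OF A r]] A
    by (simp add: m_accretive_def)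
  also have "forward_step B r x - (x + r *\<^sub>R v) = - (r *\<^sub>R (v + B x))"
    by (simp add: forward_step_def algebra_simps)
  finally show ?thesis using r by simp
qed (simp add: fb_splitting_def)

text \<open>With \<open>z = fb_splitting A B r x\<close>, the vector \<open>((x - z) / r) - B x\<close> lies in \<open>A z\<close>, so \<open>z\<close> is
  also a value of the resolvent with the smaller step size \<open>s\<close>.\<close>

lemma fb_splitting_step:
  assumes A: "m_accretive A" and s: "0 \<le> s" "s \<le> r" and r: "r > 0"
    and E: "\<And>x y. norm (forward_step B r x - forward_step B r y) \<le> norm (x - y)"
  shows "norm (fb_splitting A B r x - fb_splitting A B s y)
    \<le> (s / r) * norm (x - y) + (1 - s / r) * norm (fb_splitting A B r x - y)"
proof (cases "s = 0")
  case True
  then show ?thesis by (simp add: fb_splitting_def)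
next
  case False
  then have s0: "s > 0" using s by simp
  define z where "z = fb_splitting A B r x"
  obtain v where v: "v \<in> A z" "forward_step B r x = z + r *\<^sub>R v"
    using fb_splitting_mem[OF A r, of B x] by (auto simp: id_plus_scaled_def z_def)
  have "z + s *\<^sub>R v \<in> id_plus_scaled s A z" using v by (auto simp: id_plus_scaled_def)
  then have "norm (z - fb_splitting A B s y) \<le> norm (z + s *\<^sub>R v - forward_step B s y)"
    using accretive_nonexpansive[OF _ s0 _ fb_splitting_mem[OF A s0]] A
    by (simp add: m_accretive_def)
  \<comment> \<open>Both \<open>z + s *\<^sub>R v\<close> and the forward step of size s are
    combinations, with weights s/r and 1 - s/r, of their version at step r and of z or y.\<close>
  also have "z + s *\<^sub>R v - forward_step B s y
      = (s / r) *\<^sub>R (forward_step B r x - forward_step B r y) + (1 - s / r) *\<^sub>R (z - y)"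
    using r unfolding v(2) by (simp add: forward_step_def algebra_simps)
  also have "norm \<dots> \<le> (s / r) * norm (forward_step B r x - forward_step B r y)
      + (1 - s / r) * norm (z - y)"
    using s r by (intro order_trans[OF norm_triangle_ineq]) simp
  also have "\<dots> \<le> (s / r) * norm (x - y) + (1 - s / r) * norm (z - y)"
    using E[of x y] s r by (intro add_right_mono mult_left_mono) auto
  finally show ?thesis by (simp add: z_def)
qed

section \<open>The Crandall--Liggett estimate\<close>

text \<open>Isolates the one inequality from which convergence follows; A and B no longer appear.
  \<open>r0\<close> is the largest step size for which it is assumed.\<close>

locale crandall_liggett =
  fixes T :: "real \<Rightarrow> 'a::real_normed_vector \<Rightarrow> 'a" and r0 :: real
  assumes r0_pos: "r0 > 0"
    and T_zero: "T 0 = id"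
    and T_step: "\<And>r s x y. 0 \<le> s \<Longrightarrow> s \<le> r \<Longrightarrow> 0 < r \<Longrightarrow> r \<le> r0 \<Longrightarrow>
      norm (T r x - T s y) \<le> (s / r) * norm (x - y) + (1 - s / r) * norm (T r x - y)"
begin

lemma funpow_zero: "(T 0 ^^ n) x = x"
  by (simp add: T_zero)

lemma nonexpansive:
  assumes "0 \<le> r" "r \<le> r0"
  shows "norm (T r x - T r y) \<le> norm (x - y)"
  using T_step[of r r x y] assms by (cases "r = 0") (auto simp: T_zero)

lemma funpow_nonexpansive:
  assumes "0 \<le> r" "r \<le> r0"
  shows "norm ((T r ^^ n) x - (T r ^^ n) y) \<le> norm (x - y)"
  by (induction n) (auto intro: order_trans[OF nonexpansive[OF assms]])

text \<open>Abstract substitute for membership in the domain of A, with C in the role of |v + B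
  x|.\<close>

definition displacement_bound :: "real \<Rightarrow> 'a \<Rightarrow> bool" where
  "displacement_bound C x \<longleftrightarrow> (\<forall>r\<ge>0. norm (T r x - x) \<le> r * C)"

lemma displacement_bound_nonneg: "displacement_bound C x \<Longrightarrow> 0 \<le> C"
  using norm_ge_zero[of "T 1 x - x"] unfolding displacement_bound_def
  by (metis mult_1 order_trans zero_le_one)

lemma funpow_displacement:
  assumes r: "0 \<le> r" "r \<le> r0" and C: "displacement_bound C x"
  shows "norm ((T r ^^ n) x - x) \<le> (real n * r) * C"
proof (induction n)
  case (Suc n)
  have "norm ((T r ^^ Suc n) x - x) \<le> norm ((T r ^^ n) (T r x) - (T r ^^ n) x) + norm ((T r ^^ n) x - x)"
    using norm_triangle_ineq[of "(T r ^^ n) (T r x) - (T r ^^ n) x" "(T r ^^ n) x - x"]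
    by (simp add: funpow_swap1)
  also have "\<dots> \<le> norm (T r x - x) + (real n * r) * C"
    using funpow_nonexpansive[OF r] Suc by (rule add_mono)
  also have "norm (T r x - x) \<le> r * C" using C r by (simp add: displacement_bound_def)
  finally show ?case by (simp add: algebra_simps)
qed simp

text \<open>The function \<open>(m r - n s)\<^sup>2 + n s (r - s)\<close> solves the recursion of \<open>T_step\<close>, read for squared
  distances, with equality.\<close>

lemma funpow_dist:
  assumes s: "0 \<le> s" "s \<le> r" and r: "r \<le> r0" and C: "displacement_bound C x"
  shows "(norm ((T r ^^ m) x - (T s ^^ n) x))\<^sup>2
    \<le> C\<^sup>2 * ((real m * r - real n * s)\<^sup>2 + real n * s * (r - s))"
proof (cases "r = 0")
  case True
  then show ?thesis using s by (simp add: funpow_zero)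
next
  case False
  then have r_pos: "0 < r" using s by simp
  show ?thesis
  \<comment> \<open>The recursion at \<open>Suc k\<close> calls on the hypothesis at both k and
    \<open>Suc k\<close>, so m must vary.\<close>
  proof (induction n arbitrary: m)
    case 0
    show ?case
      using power_mono[OF funpow_displacement[OF _ r C, of m], of 2] r_pos
      by (simp add: power_mult_distrib mult.commute)
  next
    case (Suc n)
    show ?case
    proof (cases m)
      case 0
      have "(norm (x - (T s ^^ Suc n) x))\<^sup>2 \<le> (real (Suc n) * s * C)\<^sup>2"
        using funpow_displacement[OF s(1) _ C, of "Suc n"] s r
        by (intro power_mono) (auto simp: norm_minus_commute)
      also have "\<dots> \<le> C\<^sup>2 * ((real 0 * r - real (Suc n) * s)\<^sup>2 + real (Suc n) * s * (r - s))"
        using s by (simp add: power_mult_distrib power2_commute[of 0] mult.commute[of _ "C\<^sup>2"] mult_left_mono)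
      finally show ?thesis using 0 by simp
    next
      case (Suc k)
      define \<alpha> where "\<alpha> = s / r"
      have \<alpha>: "0 \<le> \<alpha>" "\<alpha> \<le> 1" "\<alpha> * r = s" using s r_pos by (auto simp: \<alpha>_def)
      define a b where "a = norm ((T r ^^ k) x - (T s ^^ n) x)"
        and "b = norm ((T r ^^ Suc k) x - (T s ^^ n) x)"
      have "norm ((T r ^^ Suc k) x - (T s ^^ Suc n) x) \<le> \<alpha> * a + (1 - \<alpha>) * b"
        using T_step[OF s r_pos r, of "(T r ^^ k) x" "(T s ^^ n) x"] by (simp add: \<alpha>_def a_def b_def)
      then have "(norm ((T r ^^ Suc k) x - (T s ^^ Suc n) x))\<^sup>2 \<le> (\<alpha> * a + (1 - \<alpha>) * b)\<^sup>2"
        by (intro power_mono) auto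
      \<comment> \<open>Convexity of the square, with its exact remainder.\<close>
      also have "\<dots> = \<alpha> * a\<^sup>2 + (1 - \<alpha>) * b\<^sup>2 - \<alpha> * (1 - \<alpha>) * (a - b)\<^sup>2"
        by (simp add: power2_eq_square algebra_simps)
      also have "\<dots> \<le> \<alpha> * a\<^sup>2 + (1 - \<alpha>) * b\<^sup>2" using \<alpha> by simp
      also have "\<dots> \<le> \<alpha> * (C\<^sup>2 * ((real k * r - real n * s)\<^sup>2 + real n * s * (r - s)))
          + (1 - \<alpha>) * (C\<^sup>2 * ((real (Suc k) * r - real n * s)\<^sup>2 + real n * s * (r - s)))"
        using Suc.IH[of k] Suc.IH[of "Suc k"] \<alpha> unfolding a_def b_def
        by (intro add_mono mult_left_mono) auto
      \<comment> \<open>Replacing s by \<open>\<alpha> * r\<close> removes the quotient and leaves a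
        polynomial identity.\<close>
      also have "\<dots> = C\<^sup>2 * ((real (Suc k) * r - real (Suc n) * s)\<^sup>2 + real (Suc n) * s * (r - s))"
        unfolding \<alpha>(3)[symmetric] by (simp add: power2_eq_square algebra_simps)
      finally show ?thesis using Suc by simp
    qed
  qed
qed

section \<open>Convergence of the approximations and regularity of the limit\<close>

abbreviation approx :: "'a \<Rightarrow> nat \<Rightarrow> real \<Rightarrow> 'a" where
  "approx x m t \<equiv> (T (t / real m) ^^ m) x"

text \<open>Both iterations run up to the same time t, so the square (m r - n s)^2 vanishes and only
  t (t/m - t/n) \<le> S^2 / m remains, uniformly in t.\<close>

lemma approx_dist:
  assumes t: "0 \<le> t" "t \<le> S" and m: "0 < m" "m \<le> n" "S / real m \<le> r0"
    and C: "displacement_bound C x"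
  shows "norm (approx x m t - approx x n t) \<le> C * S / sqrt (real m)"
proof -
  have n: "n > 0" using m by simp
  have "t / real m \<le> S / real m" using t m by (simp add: divide_right_mono)
  moreover have "t / real n \<le> t / real m" using t m by (simp add: frac_le)
  ultimately have "(norm (approx x m t - approx x n t))\<^sup>2
      \<le> C\<^sup>2 * ((real m * (t / real m) - real n * (t / real n))\<^sup>2
        + real n * (t / real n) * (t / real m - t / real n))"
    using t m by (intro funpow_dist[OF _ _ _ C]) auto
  also have "\<dots> = C\<^sup>2 * (t * (t / real m - t / real n))" using m n by simp
  also have "\<dots> \<le> C\<^sup>2 * (S * (S / real m))"
    using t m by (intro mult_left_mono mult_mono) (auto intro: order_trans[OF _ \<open>t / real m \<le> S / real m\<close>]
        \<open>t / real n \<le> t / real m\<close>)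
  also have "\<dots> = (C * S / sqrt (real m))\<^sup>2"
    by (simp add: power_mult_distrib power_divide power2_eq_square)
  finally show ?thesis
    using displacement_bound_nonneg[OF C] t by (auto intro: power2_le_imp_le)
qed

text \<open>A three-epsilon argument: x is replaced by a nearby y with a displacement bound, and
  nonexpansiveness of the powers controls this error uniformly in t and in the number of
  steps.\<close>

lemma approx_uniformly_Cauchy:
  assumes x: "x \<in> closure {y. \<exists>C. displacement_bound C y}"
  shows "uniformly_Cauchy_on {0..S} (approx x)"
proof (rule uniformly_Cauchy_onI')
  fix e :: real assume e: "e > 0"
  obtain y C where y: "norm (y - x) < e / 3" and C: "displacement_bound C y"
    using x e unfolding closure_approachable by (auto simp: dist_norm dest!: spec[of _ "e / 3"])
  have "(\<lambda>m. S / real m) \<longlonglongrightarrow> 0" "(\<lambda>m. C * S / sqrt (real m)) \<longlonglongrightarrow> 0"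
    by real_asymp+
  then have "\<forall>\<^sub>F m in sequentially. S / real m < r0 \<and> C * S / sqrt (real m) < e / 3 \<and> 0 < m"
    using e r0_pos by (intro eventually_conj eventually_gt_at_top order_tendstoD(2)) auto
  then obtain M where M: "\<And>m. m \<ge> M \<Longrightarrow> S / real m < r0 \<and> C * S / sqrt (real m) < e / 3 \<and> 0 < m"
    unfolding eventually_sequentially by blast
  show "\<exists>M. \<forall>t\<in>{0..S}. \<forall>m\<ge>M. \<forall>n>m. dist (approx x m t) (approx x n t) < e"
  proof (intro exI[of _ M] ballI allI impI)
    fix t m n assume t: "t \<in> {0..S}" and m: "M \<le> m" and n: "m < n"
    have close: "norm (approx x k t - approx y k t) < e / 3" if "M \<le> k" for k
    proof -
      have "t / real k \<le> S / real k" using t by (simp add: divide_right_mono)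
      then have "norm (approx x k t - approx y k t) \<le> norm (x - y)"
        using M[OF that] t by (intro funpow_nonexpansive) auto
      then show ?thesis using y by (simp add: norm_minus_commute)
    qed
    have "norm (approx y m t - approx y n t) \<le> C * S / sqrt (real m)"
      using M[OF m] t n by (intro approx_dist[OF _ _ _ _ _ C]) auto
    also have "\<dots> < e / 3" using M[OF m] by simp
    finally have "norm (approx y m t - approx y n t) < e / 3" .
    then have "norm ((approx x m t - approx y m t) + (approx y m t - approx y n t)
        - (approx x n t - approx y n t)) < e"
      using close[OF m] close[of n] m n
        norm_triangle_ineq4[of "(approx x m t - approx y m t) + (approx y m t - approx y n t)"
          "approx x n t - approx y n t"]
        norm_triangle_ineq[of "approx x m t - approx y m t" "approx y m t - approx y n t"]
      by simp
    then show "dist (approx x m t) (approx x n t) < e" by (simp add: dist_norm)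
  qed
qed

text \<open>With equal numbers m of steps of sizes t/m and s/m, the correction term of
  \<open>funpow_dist\<close> is s (t - s) / m and disappears in the limit.\<close>

lemma limit_lipschitz:
  assumes C: "displacement_bound C x"
    and u: "\<And>t. t \<ge> 0 \<Longrightarrow> (\<lambda>m. approx x m t) \<longlonglongrightarrow> u t"
  shows "C-lipschitz_on {0..} u"
proof -
  have C0: "0 \<le> C" by (rule displacement_bound_nonneg[OF C])
  have *: "norm (u t - u s) \<le> C * (t - s)" if st: "0 \<le> s" "s \<le> t" for s t
  proof -
    have "(\<lambda>m. t / real m) \<longlonglongrightarrow> 0" by real_asymp
    then have ev: "\<forall>\<^sub>F m in sequentially. t / real m < r0 \<and> 0 < m"
      using r0_pos by (intro eventually_conj eventually_gt_at_top) (auto dest: order_tendstoD(2))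
    have "(norm (u t - u s))\<^sup>2 \<le> C\<^sup>2 * (t - s)\<^sup>2"
    proof (rule tendsto_le[OF sequentially_bot])
      show "(\<lambda>m. (norm (approx x m t - approx x m s))\<^sup>2) \<longlonglongrightarrow> (norm (u t - u s))\<^sup>2"
        using st by (intro tendsto_intros u) auto
      show "(\<lambda>m. C\<^sup>2 * ((t - s)\<^sup>2 + s * (t - s) / real m)) \<longlonglongrightarrow> C\<^sup>2 * (t - s)\<^sup>2"
        by real_asymp
      show "\<forall>\<^sub>F m in sequentially. (norm (approx x m t - approx x m s))\<^sup>2
          \<le> C\<^sup>2 * ((t - s)\<^sup>2 + s * (t - s) / real m)"
        using ev
      proof eventually_elim
        case (elim m)
        then have "(norm (approx x m t - approx x m s))\<^sup>2
          \<le> C\<^sup>2 * ((real m * (t / real m) - real m * (s / real m))\<^sup>2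
            + real m * (s / real m) * (t / real m - s / real m))"
          using st by (intro funpow_dist[OF _ _ _ C]) (auto simp: divide_right_mono)
        then show ?case using elim by (simp add: diff_divide_distrib right_diff_distrib)
      qed
    qed
    then have "(norm (u t - u s))\<^sup>2 \<le> (C * (t - s))\<^sup>2" by (simp add: power_mult_distrib)
    then show ?thesis using C0 st by (auto intro: power2_le_imp_le)
  qed
  show ?thesis
  proof (rule lipschitz_onI[OF _ C0])
    fix t s :: real assume "t \<in> {0..}" "s \<in> {0..}"
    then show "dist (u t) (u s) \<le> C * dist t s"
      using *[of s t] *[of t s]
      by (cases "s \<le> t") (auto simp: dist_norm norm_minus_commute abs_if)
  qed
qed

end

text \<open>Each difference quotient is a lower bound for all the constants, hence for their
  infimum.\<close>

lemma lipschitz_on_INF_ennreal: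
  fixes f :: "'b::metric_space \<Rightarrow> 'c::metric_space" and c :: "'i \<Rightarrow> real"
  assumes ne: "I \<noteq> {}" and lip: "\<And>i. i \<in> I \<Longrightarrow> (c i)-lipschitz_on X f"
  shows "(enn2real (INF i\<in>I. ennreal (c i)))-lipschitz_on X f"
proof (rule lipschitz_onI)
  fix x y assume xy: "x \<in> X" "y \<in> X"
  let ?C = "INF i\<in>I. ennreal (c i)"
  obtain i where "i \<in> I" using ne by blast
  \<comment> \<open>Finiteness matters because \<open>enn2real\<close> sends the top element to
    0.\<close>
  then have fin: "?C < top" by (rule INF_lower[THEN le_less_trans]) simp
  show "dist (f x) (f y) \<le> enn2real ?C * dist x y"
  proof (cases "x = y")
    case False
    then have d: "dist x y > 0" by simp
    have "ennreal (dist (f x) (f y) / dist x y) \<le> ?C"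
    proof (rule INF_greatest)
      fix i assume "i \<in> I"
      then have "dist (f x) (f y) / dist x y \<le> c i"
        using lipschitz_onD[OF lip xy] d by (simp add: field_simps)
      then show "ennreal (dist (f x) (f y) / dist x y) \<le> ennreal (c i)" by (rule ennreal_leI)
    qed
    then have "enn2real (ennreal (dist (f x) (f y) / dist x y)) \<le> enn2real ?C"
      using fin by (rule enn2real_mono)
    then show ?thesis using d by (simp add: field_simps)
  qed simp
qed simp

theorem proposition3p1:
  fixes A :: "'a::banach \<Rightarrow> 'a set" and B :: "'a \<Rightarrow> 'a" and \<theta> :: real and u0 :: 'a
  assumes "two_uniformly_convex TYPE('a \<Rightarrow>\<^sub>L real)"
    and "m_accretive A"
    and "\<theta> > 0" and "cocoercive \<theta> B"
    and "u0 \<in> closure (op_domain A)"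
  shows "\<exists>u :: real \<Rightarrow> 'a.
    (\<forall>t\<ge>0. (\<lambda>m. fb_approx A B u0 m t) \<longlonglongrightarrow> u t) \<and>
    (\<forall>S>0. uniform_limit {0..S} (fb_approx A B u0) u sequentially) \<and>
    (min_norm_sum A B u0 < \<infinity> \<longrightarrow> (enn2real (min_norm_sum A B u0))-lipschitz_on {0..} u)"
proof -
  obtain c where mid: "midpoint_convex_with c TYPE('a \<Rightarrow>\<^sub>L real)"
    using two_uniformly_convex_midpoint[OF assms(1)] .
  then have c: "c > 0" by (simp add: midpoint_convex_with_def)
  \<comment> \<open>The step size bound is the range in which the forward step is
    nonexpansive.\<close>
  interpret crandall_liggett "fb_splitting A B" "4 * c * \<theta>"
  proof
    show "4 * c * \<theta> > 0" using c assms(3) by simp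
    show "fb_splitting A B 0 = id" by (simp add: fb_splitting_def)
    show "norm (fb_splitting A B r x - fb_splitting A B s y)
      \<le> s / r * norm (x - y) + (1 - s / r) * norm (fb_splitting A B r x - y)"
      if "0 \<le> s" "s \<le> r" "0 < r" "r \<le> 4 * c * \<theta>" for r s x y
      using that by (intro fb_splitting_step[OF assms(2)] forward_step_nonexpansive[OF mid assms(4)]) auto
  qed
  have approx_eq: "fb_approx A B u0 = approx u0"
    by (intro ext) (simp add: fb_approx_def)
  have bound: "displacement_bound (norm (v + B x)) x" if "v \<in> A x" for v x
    using fb_splitting_displacement[OF assms(2) _ that] by (simp add: displacement_bound_def)
  then have "op_domain A \<subseteq> {y. \<exists>C. displacement_bound C y}" by (auto simp: op_domain_def)
  then have "u0 \<in> closure {y. \<exists>C. displacement_bound C y}"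
    using assms(5) closure_mono by blast
  then have cauchy: "uniformly_Cauchy_on {0..S} (approx u0)" for S
    by (rule approx_uniformly_Cauchy)
  define u where "u t = lim (\<lambda>m. approx u0 m t)" for t
  have unif: "uniform_limit {0..S} (approx u0) u sequentially" for S
    using Cauchy_uniformly_convergent[OF cauchy[of S]] unfolding u_def
    by (simp add: uniformly_convergent_uniform_limit_iff)
  have ptw: "(\<lambda>m. approx u0 m t) \<longlonglongrightarrow> u t" if "t \<ge> 0" for t
    using tendsto_uniform_limitI[OF unif[of t], of t] that by simp
  have "(enn2real (min_norm_sum A B u0))-lipschitz_on {0..} u" if "min_norm_sum A B u0 < \<infinity>"
    unfolding min_norm_sum_def
  proof (rule lipschitz_on_INF_ennreal)
    \<comment> \<open>Over the empty set the infimum would be infinite.\<close>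
    show "A u0 \<noteq> {}" using that by (auto simp: min_norm_sum_def)
    show "(norm (v + B u0))-lipschitz_on {0..} u" if "v \<in> A u0" for v
      by (rule limit_lipschitz[OF bound[OF that] ptw])
  qed
  then show ?thesis
    unfolding approx_eq by (intro exI[of _ u] conjI allI impI ptw unif)
qed

end
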